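(* Let $c>0$. The moment problems associated with the Conrad--Flajolet polynomials I and with the Conrad--Flajolet polynomials II are both indeterminate; that is, for each of these two families the (positive) orthogonality measure on $\mathbb{R}$ is not unique.
   Context: Given rates $\lambda_n,\mu_n$, the associated birth and death process polynomials are defined by $\mathcal{Q}_0(x)=1$, $\mathcal{Q}_1(x)=(\lambda_0+\mu_0-x)/\lambda_0$ and $-x\mathcal{Q}_n(x)=\lambda_n\mathcal{Q}_{n+1}(x)+\mu_n\mathcal{Q}_{n-1}(x)-(\lambda_n+\mu_n)\mathcal{Q}_n(x)$ for $n\ge1$. The Conrad--Flajolet polynomials I correspond to $\lambda_n=(3n+c+1)(3n+c+2)^2$, $\mu_n=(3n+c)^2(3n+c+1)$; the Conrad--Flajolet polynomials II correspond to $\lambda_n=(3n+c+1)^2(3n+c+2)$, $\mu_n=(3n+c-1)(3n+c)^2$. The corresponding orthonormal polynomials $\widehat{\mathcal{Q}}_n(x)=(-1)^n\mathcal{Q}_n(x)\sqrt{\prod_{k=1}^n\lambda_{k-1}/\mu_k}$ satisfy $x\widehat{\mathcal{Q}}_n=b_{n+1}\widehat{\mathcal{Q}}_{n+1}+a_n\widehat{\mathcal{Q}}_n+b_n\widehat{\mathcal{Q}}_{n-1}$ with $a_n=\lambda_n+\mu_n$ and $b_n=\sqrt{\lambda_{n-1}\mu_n}$. The associated moment problem is the Hamburger moment problem: find positive measures on $\mathbb{R}$ (normalized to total mass 1) with finite moments with respect to which the $\widehat{\mathcal{Q}}_n$ are orthonormal; it is indeterminate if it has more than one solution. *)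

theory Defs
  imports "HOL-Probability.Probability" "HOL-Computational_Algebra.Polynomial"
begin

text \<open>Birth and death process polynomials with rates \<open>l\<close> (birth) and \<open>m\<close> (death). The recurrence
  is solved for its leading term; the lemma \<open>bd_poly_recurrence\<close> gives it in its usual form.\<close>

fun bd_poly :: "(nat \<Rightarrow> real) \<Rightarrow> (nat \<Rightarrow> real) \<Rightarrow> nat \<Rightarrow> real poly" where
  "bd_poly l m 0 = 1"
| "bd_poly l m (Suc 0) = smult (1 / l 0) [:l 0 + m 0, - 1:]"
| "bd_poly l m (Suc (Suc n)) =
     smult (1 / l (Suc n))
       ([:l (Suc n) + m (Suc n), - 1:] * bd_poly l m (Suc n) - smult (m (Suc n)) (bd_poly l m n))"

lemma bd_poly_recurrence:
  assumes "n \<ge> 1" "l n \<noteq> 0"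
  shows "- x * poly (bd_poly l m n) x =
    l n * poly (bd_poly l m (n + 1)) x + m n * poly (bd_poly l m (n - 1)) x
      - (l n + m n) * poly (bd_poly l m n) x"
  using assms by (cases n) (simp_all add: algebra_simps)

definition bd_orthonormal :: "(nat \<Rightarrow> real) \<Rightarrow> (nat \<Rightarrow> real) \<Rightarrow> nat \<Rightarrow> real poly" where
  "bd_orthonormal l m n =
     smult ((- 1) ^ n * sqrt (\<Prod>k = 1..n. l (k - 1) / m k)) (bd_poly l m n)"

definition hamburger_solution :: "(nat \<Rightarrow> real poly) \<Rightarrow> real measure \<Rightarrow> bool" where
  "hamburger_solution P M \<longleftrightarrow>
     sets M = sets borel \<and> prob_space M \<and>
     (\<forall>n. integrable M (\<lambda>x. x ^ n)) \<and>
     (\<forall>i j. (\<integral>x. poly (P i) x * poly (P j) x \<partial>M) = (if i = j then 1 else 0))"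

definition indeterminate :: "(nat \<Rightarrow> real poly) \<Rightarrow> bool" where
  "indeterminate P \<longleftrightarrow>
     (\<exists>M N. hamburger_solution P M \<and> hamburger_solution P N \<and> M \<noteq> N)"

definition cf1_birth :: "real \<Rightarrow> nat \<Rightarrow> real" where
  "cf1_birth c n = (3 * real n + c + 1) * (3 * real n + c + 2)\<^sup>2"

definition cf1_death :: "real \<Rightarrow> nat \<Rightarrow> real" where
  "cf1_death c n = (3 * real n + c)\<^sup>2 * (3 * real n + c + 1)"

definition cf2_birth :: "real \<Rightarrow> nat \<Rightarrow> real" where
  "cf2_birth c n = (3 * real n + c + 1)\<^sup>2 * (3 * real n + c + 2)"

text \<open>For \<open>0 < c \<le> 1\<close> the value at \<open>n = 0\<close> is not positive. It enters the recurrence only through the degree-one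
  polynomial; the weights in \<open>bd_orthonormal\<close> use death rates with index at least 1.\<close>

definition cf2_death :: "real \<Rightarrow> nat \<Rightarrow> real" where
  "cf2_death c n = (3 * real n + c - 1) * (3 * real n + c)\<^sup>2"

end

theory Submission
  imports Defs "HOL-Computational_Algebra.Fundamental_Theorem_Algebra"
    "HOL-Real_Asymp.Real_Asymp"
begin

text \<open>Let \<open>Q n\<close> be the birth and death polynomials with rates \<open>l\<close>, \<open>m\<close>, and let
\<open>wt n = l 0 \<cdots> l (n-1) / (m 1 \<cdots> m n)\<close>, so that the orthonormal polynomials are
\<open>(-1)^n * sqrt (wt n) * Q n\<close> and their Christoffel--Darboux kernel on the diagonal is
\<open>kern n x x = (\<Sum>k\<le>n. wt k * Q k x ^ 2)\<close>. The moment problem turns out to be indeterminate as soon as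
\<open>\<Sum> wt n\<close> and \<open>\<Sum> 1 / (l n * wt n)\<close> both converge (\<open>indeterminate_of_summable\<close>). The point is that
the recurrence, written for \<open>Q n\<close> and the differences \<open>l n * wt n * (Q (n+1) - Q n)\<close>, has
exactly these two summable sequences as coefficients. A discrete Gronwall argument (\<open>Q_growth\<close>) then bounds
\<open>Q n x\<close> uniformly in \<open>n\<close> and \<open>x \<in> {-1..1}\<close>, hence \<open>kern n x x \<le> B\<close> there with a single constant \<open>B\<close>.

On the other hand, for every real \<open>x\<close> with \<open>kern n x x \<le> B\<close> for all \<open>n\<close>, some solution has an atom
of mass at least \<open>1/B\<close> at \<open>x\<close> (\<open>ex_solution_with_atom\<close>). It is a weak limit of Gauss
quadratures one of whose nodes is forced to be \<open>x\<close>: the nodes are the roots of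
\<open>Q (n+1) - \<tau> * Q n\<close> with \<open>\<tau>\<close> chosen to make \<open>x\<close> a root, and the weight of a node \<open>s\<close> is
\<open>1 / kern n s s\<close>. Moments survive the limit because the higher moments of the quadratures are
eventually constant, and the mass at the closed set \<open>{x}\<close> cannot drop in a weak limit.

If the solution were unique, this one probability measure would have mass at least \<open>1/B\<close> at each point
of \<open>{0..1}\<close>, which is absurd: take more than \<open>B\<close> points. Existence of a solution and its
non-uniqueness thus come out of the same construction.

For the two cubic families, \<open>wt n\<close> decays like \<open>n powr (-5/3)\<close> and \<open>1 / (l n * wt n)\<close> like
\<open>n powr (-4/3)\<close>, respectively the other way round, so both series converge by Raabe's test.\<close>

section \<open>Weak limits of measures on the line\<close>

lemma borel_measurable_poly [measurable]:
  "poly (p :: real poly) \<in> borel_measurable borel"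
  by (intro borel_measurable_continuous_onI continuous_intros)

lemma tight_of_bounded_second_moment:
  fixes \<mu> :: "nat \<Rightarrow> real measure"
  assumes dist: "\<And>n. real_distribution (\<mu> n)"
    and int: "\<And>n. integrable (\<mu> n) (\<lambda>x. x\<^sup>2)"
    and bound: "\<And>n. (\<integral>x. x\<^sup>2 \<partial>\<mu> n) \<le> B"
  shows "tight \<mu>"
  unfolding tight_def
proof (intro conjI allI impI)
  fix \<epsilon> :: real assume "\<epsilon> > 0"
  have "0 \<le> (\<integral>x. x\<^sup>2 \<partial>\<mu> 0)" by (intro integral_nonneg_AE) auto
  with bound[of 0] have B: "0 \<le> B" by linarith
  define a where "a = 1 + B / \<epsilon>"
  have a: "a \<ge> 1" using B \<open>\<epsilon> > 0\<close> by (simp add: a_def)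
  have "B / a\<^sup>2 < \<epsilon>"
  proof -
    have "B < \<epsilon> * a" using \<open>\<epsilon> > 0\<close> by (simp add: a_def field_simps)
    also have "\<dots> \<le> \<epsilon> * a\<^sup>2"
      using a \<open>\<epsilon> > 0\<close> by (intro mult_left_mono) (auto simp: power2_eq_square)
    finally show ?thesis using a by (simp add: field_simps)
  qed
  show "\<exists>a b. a < b \<and> (\<forall>n. 1 - \<epsilon> < measure (\<mu> n) {a<..b})"
  proof (intro exI conjI allI)
    show "- a < a" using a by simp
    fix n
    interpret real_distribution "\<mu> n" by (rule dist)
    have "prob (space (\<mu> n) - {-a<..a}) \<le> prob {x \<in> space (\<mu> n). a\<^sup>2 \<le> x\<^sup>2}"
    proof (rule finite_measure_mono)
      have "a\<^sup>2 \<le> x\<^sup>2" if "x \<le> - a \<or> a < x" for x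
        using a that by (intro abs_le_square_iff[THEN iffD1]) auto
      then show "space (\<mu> n) - {-a<..a} \<subseteq> {x \<in> space (\<mu> n). a\<^sup>2 \<le> x\<^sup>2}"
        by (auto simp: not_le not_less)
    qed simp
    also have "\<dots> \<le> (\<integral>x. x\<^sup>2 \<partial>\<mu> n) / a\<^sup>2"
      using a by (intro integral_Markov_inequality_measure[where A = "{}"] int) auto
    also have "\<dots> \<le> B / a\<^sup>2" using bound by (intro divide_right_mono) auto
    also have "\<dots> < \<epsilon>" by fact
    finally show "1 - \<epsilon> < prob {-a<..a}" by (subst (asm) prob_compl) auto
  qed
qed (rule dist)

text \<open>Weak convergence only controls bounded continuous functions, so \<open>f\<close> is cut off at height \<open>K\<close>. A
uniform bound on the second moment of \<open>f\<close> makes the error of the cut-off at most \<open>B / K\<close>, because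
the part of \<open>f\<close> beyond \<open>K\<close> is dominated by \<open>f\<^sup>2 / K\<close>; this bound passes to the limit by monotone
convergence.\<close>

lemma weak_limit_integral:
  fixes \<mu> :: "nat \<Rightarrow> real measure" and f :: "real \<Rightarrow> real"
  assumes dist: "\<And>n. real_distribution (\<mu> n)" and distM: "real_distribution M"
    and conv: "weak_conv_m \<mu> M" and cont: "\<And>x. isCont f x"
    and int: "\<And>n. integrable (\<mu> n) f" and int2: "\<And>n. integrable (\<mu> n) (\<lambda>x. (f x)\<^sup>2)"
    and bound: "\<And>n. (\<integral>x. (f x)\<^sup>2 \<partial>\<mu> n) \<le> B"
    and lim: "(\<lambda>n. \<integral>x. f x \<partial>\<mu> n) \<longlonglongrightarrow> s"
  shows "integrable M f" "(\<integral>x. f x \<partial>M) = s"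
proof -
  interpret M: real_distribution M by fact
  interpret \<mu>: real_distribution "\<mu> n" for n by (rule dist)
  have meas[measurable]: "f \<in> borel_measurable borel"
    using cont by (intro borel_measurable_continuous_onI continuous_at_imp_continuous_on) auto
  note weak = weak_conv_imp_integral_bdd_continuous_conv[OF dist distM conv]
  define g where "g k x = min (real k) ((f x)\<^sup>2)" for k x
  have g_int: "integrable M (g k)" "integrable (\<mu> n) (g k)" for k n
    unfolding g_def
    by (rule M.integrable_const_bound[where B = "real k"] \<mu>.integrable_const_bound[where B = "real k"]; simp)+
  have g_le: "(\<integral>x. g k x \<partial>M) \<le> B" for k
  proof (rule LIMSEQ_le_const2)
    show "(\<lambda>n. \<integral>x. g k x \<partial>\<mu> n) \<longlonglongrightarrow> (\<integral>x. g k x \<partial>M)"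
      by (rule weak[where B = "real k"]) (auto simp: g_def intro!: continuous_intros cont)
    have "(\<integral>x. g k x \<partial>\<mu> n) \<le> B" for n
      by (rule order_trans[OF integral_mono bound[of n]]) (auto simp: g_int int2, simp add: g_def)
    then show "\<exists>N. \<forall>n\<ge>N. (\<integral>x. g k x \<partial>\<mu> n) \<le> B" by blast
  qed
  have "incseq (\<lambda>k. \<integral>x. g k x \<partial>M)"
    by (intro incseq_SucI integral_mono g_int) (auto simp: g_def)
  then obtain t where t: "(\<lambda>k. \<integral>x. g k x \<partial>M) \<longlonglongrightarrow> t" "\<And>k. (\<integral>x. g k x \<partial>M) \<le> t"
    using incseq_convergent[of "\<lambda>k. \<integral>x. g k x \<partial>M" B] g_le by blast
  have "t \<le> B" using t(1) g_le by (intro LIMSEQ_le_const2) auto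
  have g_lim: "(\<lambda>k. g k x) \<longlonglongrightarrow> (f x)\<^sup>2" for x
  proof (rule tendsto_eventually)
    obtain N where "(f x)\<^sup>2 \<le> real N" using real_arch_simple by blast
    then show "\<forall>\<^sub>F k in sequentially. g k x = (f x)\<^sup>2"
      by (intro eventually_sequentiallyI[of N]) (auto simp: g_def min_def)
  qed
  have "has_bochner_integral M (\<lambda>x. (f x)\<^sup>2) t"
  proof (rule has_bochner_integral_monotone_convergence[where f = g])
    show "AE x in M. mono (\<lambda>k. g k x)" by (auto simp: g_def mono_def)
  qed (use g_int t g_lim in auto)
  then have f2: "integrable M (\<lambda>x. (f x)\<^sup>2)" "(\<integral>x. (f x)\<^sup>2 \<partial>M) \<le> B"
    using \<open>t \<le> B\<close> by (auto simp: has_bochner_integral_iff)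
  show fint: "integrable M f"
    by (rule M.square_integrable_imp_integrable[OF _ f2(1)]) simp
  define h where "h K x = max (- K) (min K (f x))" for K x :: real
  have h_diff: "\<bar>f x - h K x\<bar> \<le> (f x)\<^sup>2 / K" if "K > 0" for K x
  proof (cases "\<bar>f x\<bar> \<le> K")
    case True
    then show ?thesis using that by (auto simp: h_def abs_le_iff)
  next
    case False
    then have "\<bar>f x - h K x\<bar> \<le> \<bar>f x\<bar>" using that by (auto simp: h_def max_def min_def)
    also have "\<dots> * K \<le> \<bar>f x\<bar> * \<bar>f x\<bar>" using False by (intro mult_left_mono) auto
    then have "\<bar>f x\<bar> \<le> (f x)\<^sup>2 / K" using that by (simp add: field_simps power2_eq_square)
    finally show ?thesis .
  qed
  have h_int: "integrable M (h K)" "integrable (\<mu> n) (h K)" if "K > 0" for K n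
    unfolding h_def using that
    by (intro M.integrable_const_bound[where B = K] \<mu>.integrable_const_bound[where B = K];
        auto simp: abs_le_iff)+
  have cut: "\<bar>(\<integral>x. f x \<partial>N) - (\<integral>x. h K x \<partial>N)\<bar> \<le> B / K"
    if "integrable N f" "integrable N (h K)" "integrable N (\<lambda>x. (f x)\<^sup>2)"
      "(\<integral>x. (f x)\<^sup>2 \<partial>N) \<le> B" "K > 0" for N :: "real measure" and K
  proof -
    have "\<bar>(\<integral>x. f x \<partial>N) - (\<integral>x. h K x \<partial>N)\<bar> = \<bar>\<integral>x. f x - h K x \<partial>N\<bar>" using that by simp
    also have "\<dots> \<le> (\<integral>x. \<bar>f x - h K x\<bar> \<partial>N)" by (rule integral_abs_bound)
    also have "\<dots> \<le> (\<integral>x. (f x)\<^sup>2 / K \<partial>N)"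
      using that h_diff by (intro integral_mono) auto
    also have "\<dots> \<le> B / K" using that by (simp add: divide_right_mono)
    finally show ?thesis .
  qed
  have close: "\<bar>(\<integral>x. f x \<partial>M) - s\<bar> \<le> 2 * B / K" if "K > 0" for K
  proof -
    have "(\<lambda>n. \<integral>x. h K x \<partial>\<mu> n) \<longlonglongrightarrow> (\<integral>x. h K x \<partial>M)"
      by (rule weak[where B = K]) (use that in \<open>auto simp: h_def abs_le_iff intro!: continuous_intros cont\<close>)
    then have "(\<lambda>n. \<bar>(\<integral>x. f x \<partial>\<mu> n) - (\<integral>x. h K x \<partial>\<mu> n)\<bar>) \<longlonglongrightarrow> \<bar>s - (\<integral>x. h K x \<partial>M)\<bar>"
      by (intro tendsto_intros lim)
    then have "\<bar>s - (\<integral>x. h K x \<partial>M)\<bar> \<le> B / K"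
      by (rule LIMSEQ_le_const2) (use cut[OF int h_int(2) int2 bound that] that in blast)
    moreover have "\<bar>(\<integral>x. f x \<partial>M) - (\<integral>x. h K x \<partial>M)\<bar> \<le> B / K"
      using cut[OF fint h_int(1) f2 that] that by blast
    moreover have "2 * B / K = B / K + B / K" by simp
    ultimately show ?thesis by linarith
  qed
  have "(\<lambda>n. 2 * B / real (Suc n)) \<longlonglongrightarrow> 0" by real_asymp
  then have "\<bar>(\<integral>x. f x \<partial>M) - s\<bar> \<le> 0"
    by (rule LIMSEQ_le_const) (use close in auto)
  then show "(\<integral>x. f x \<partial>M) = s" by simp
qed

text \<open>A point is a closed set, so mass sitting on it can only increase in a weak limit. Tent functions
between the indicators of \<open>{x}\<close> and of a small ball replace the general portmanteau theorem.\<close>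

lemma weak_limit_atom:
  fixes \<mu> :: "nat \<Rightarrow> real measure"
  assumes dist: "\<And>n. real_distribution (\<mu> n)" and distM: "real_distribution M"
    and conv: "weak_conv_m \<mu> M" and atom: "\<And>n. \<rho> \<le> measure (\<mu> n) {x}"
  shows "\<rho> \<le> measure M {x}"
proof -
  interpret M: real_distribution M by fact
  interpret \<mu>: real_distribution "\<mu> n" for n by (rule dist)
  define A where "A k = cball x (1 / real (Suc k))" for k
  define h where "h k y = max 0 (1 - real (Suc k) * \<bar>y - x\<bar>)" for k y
  have h1: "h k y \<le> indicator (A k) y" for k y
    by (auto simp: h_def A_def indicator_def dist_real_def field_simps abs_minus_commute)
  have h2: "indicator {x} y \<le> h k y" for k y
    by (auto simp: h_def indicator_def)
  have h_cont: "isCont (h k) y" for k y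
    unfolding h_def by (intro continuous_intros)
  have [measurable]: "h k \<in> borel_measurable borel" for k
    using h_cont by (intro borel_measurable_continuous_onI continuous_at_imp_continuous_on) auto
  have h_bound: "norm (h k y) \<le> 1" for k y by (auto simp: h_def)
  have h_int: "integrable M (h k)" "integrable (\<mu> n) (h k)" for k n
    using h_bound by (auto intro: M.integrable_const_bound[where B = 1] \<mu>.integrable_const_bound[where B = 1])
  have "\<rho> \<le> measure M (A k)" for k
  proof -
    have "\<rho> \<le> (\<integral>y. h k y \<partial>\<mu> n)" for n
    proof -
      have "measure (\<mu> n) {x} = (\<integral>y. indicator {x} y \<partial>\<mu> n)" by simp
      also have "\<dots> \<le> (\<integral>y. h k y \<partial>\<mu> n)"
        using h2 by (intro integral_mono h_int) (auto simp: less_top[symmetric])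
      finally show ?thesis using atom[of n] by simp
    qed
    then have "\<rho> \<le> (\<integral>y. h k y \<partial>M)"
      using LIMSEQ_le_const[OF
          weak_conv_imp_integral_bdd_continuous_conv[OF dist distM conv h_cont h_bound]]
      by blast
    also have "\<dots> \<le> (\<integral>y. indicator (A k) y \<partial>M)"
      using h1 by (intro integral_mono h_int) (auto simp: less_top[symmetric] A_def)
    finally show ?thesis by (simp add: A_def)
  qed
  moreover have "decseq A"
    unfolding A_def by (intro decseq_SucI subset_cball) (simp add: field_simps)
  then have "(\<lambda>k. measure M (A k)) \<longlonglongrightarrow> measure M (\<Inter>k. A k)"
    by (intro M.finite_Lim_measure_decseq) (simp add: A_def image_subset_iff)
  moreover have "(\<Inter>k. A k) = {x}"
  proof -
    have "y = x" if y: "\<And>k. y \<in> A k" for y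
    proof -
      have "(\<lambda>k. 1 / real (Suc k)) \<longlonglongrightarrow> 0" by real_asymp
      then have "dist x y \<le> 0"
        by (rule LIMSEQ_le_const) (use y in \<open>auto simp: A_def\<close>)
      then show ?thesis by simp
    qed
    then show ?thesis by (auto simp: A_def)
  qed
  ultimately show ?thesis by (intro LIMSEQ_le_const) auto
qed

section \<open>Real polynomials at complex arguments\<close>

declare bd_poly.simps(2,3) [simp del]

abbreviation cpoly :: "real poly \<Rightarrow> complex poly" where
  "cpoly \<equiv> map_poly complex_of_real"

lemma cpoly_add: "cpoly (p + q) = cpoly p + cpoly q"
  by (simp add: poly_eq_iff coeff_map_poly)

lemma cpoly_smult: "cpoly (smult a p) = smult (of_real a) (cpoly p)"
  by (simp add: poly_eq_iff coeff_map_poly)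

lemma cpoly_diff: "cpoly (p - q) = cpoly p - cpoly q"
  by (simp add: poly_eq_iff coeff_map_poly)

lemma cpoly_mult: "cpoly (p * q) = cpoly p * cpoly q"
  by (simp add: poly_eq_iff coeff_map_poly coeff_mult)

lemma poly_cpoly_of_real: "poly (cpoly p) (of_real x) = of_real (poly p x)"
  by (induction p) (auto simp: map_poly_pCons)

lemma poly_cpoly_cnj: "poly (cpoly p) (cnj z) = cnj (poly (cpoly p) z)"
  by (induction p) (auto simp: map_poly_pCons)

section \<open>Birth and death polynomials and the Christoffel--Darboux formula\<close>

text \<open>The sign of \<open>m 0\<close> is left open because the second Conrad--Flajolet family has \<open>m 0 \<le> 0\<close> when \<open>c \<le> 1\<close>.\<close>

locale birth_death =
  fixes l m :: "nat \<Rightarrow> real"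
  assumes l_pos: "\<And>n. 0 < l n" and m_pos: "\<And>n. 0 < m (Suc n)"
begin

abbreviation Q :: "nat \<Rightarrow> real poly" where "Q \<equiv> bd_poly l m"

definition wt :: "nat \<Rightarrow> real" where "wt n = (\<Prod>k = 1..n. l (k - 1) / m k)"

definition kern :: "nat \<Rightarrow> real \<Rightarrow> real \<Rightarrow> real" where
  "kern n x y = (\<Sum>k\<le>n. wt k * poly (Q k) x * poly (Q k) y)"

lemma wt_0 [simp]: "wt 0 = 1"
  by (simp add: wt_def)

lemma wt_Suc: "wt (Suc n) = wt n * l n / m (Suc n)"
  by (simp add: wt_def)

lemma m_wt_Suc: "m (Suc n) * wt (Suc n) = l n * wt n"
  using m_pos[of n] by (simp add: wt_Suc)

lemma wt_pos: "0 < wt n"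
  using l_pos m_pos by (induction n) (auto simp: wt_Suc)

lemma degree_Q: "degree (Q n) = n"
proof (induction n rule: induct_nat_012)
  case (ge2 n)
  have "degree ([:l (Suc n) + m (Suc n), - 1:] * Q (Suc n)) = Suc (Suc n)"
    using ge2 by (subst degree_mult_eq) auto
  moreover have "degree (smult (m (Suc n)) (Q n)) < Suc (Suc n)"
    using ge2 degree_smult_le[of "m (Suc n)" "Q n"] by linarith
  ultimately have "degree ([:l (Suc n) + m (Suc n), - 1:] * Q (Suc n) - smult (m (Suc n)) (Q n))
      = Suc (Suc n)"
    by (metis degree_add_eq_left degree_minus diff_conv_add_uminus)
  then show ?case using l_pos[of "Suc n"] by (simp add: bd_poly.simps(3))
qed (use l_pos[of 0] in \<open>auto simp: bd_poly.simps(2)\<close>)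

lemma Q_nonzero: "Q n \<noteq> 0"
  using degree_Q[of n] by (cases n) auto

lemma poly_cpoly_Q_0 [simp]: "poly (cpoly (Q 0)) z = 1"
  by (simp add: one_pCons map_poly_pCons)

lemma poly_cpoly_Q_1:
  "of_real (l 0) * poly (cpoly (Q (Suc 0))) z = of_real (l 0 + m 0) - z"
  using l_pos[of 0] by (simp add: bd_poly.simps(2) cpoly_smult map_poly_pCons field_simps)

lemma poly_cpoly_Q_rec:
  "of_real (l (Suc n)) * poly (cpoly (Q (Suc (Suc n)))) z =
     (of_real (l (Suc n) + m (Suc n)) - z) * poly (cpoly (Q (Suc n))) z
       - of_real (m (Suc n)) * poly (cpoly (Q n)) z"
  using l_pos[of "Suc n"]
  by (simp del: mult_pCons_left add: bd_poly.simps(3) cpoly_smult cpoly_mult cpoly_diff map_poly_pCons)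

text \<open>Stated over the complex numbers since the roots of quasi-orthogonal polynomials are first located there.
The identity \<open>m (n+1) * wt (n+1) = l n * wt n\<close>, which symmetrizes the recurrence, makes the sum telescope.\<close>

lemma christoffel_darboux_complex:
  fixes x y :: complex
  defines "q k z \<equiv> poly (cpoly (Q k)) z"
  shows "of_real (l n * wt n) * (q (Suc n) x * q n y - q n x * q (Suc n) y) =
    (y - x) * (\<Sum>k\<le>n. of_real (wt k) * q k x * q k y)"
proof (induction n)
  case 0
  have "of_real (l 0 * wt 0) * (q (Suc 0) x * q 0 y - q 0 x * q (Suc 0) y) =
      of_real (l 0) * q (Suc 0) x - of_real (l 0) * q (Suc 0) y"
    unfolding q_def by (simp add: algebra_simps)
  also have "\<dots> = y - x"
    unfolding q_def poly_cpoly_Q_1 by simp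
  finally show ?case by (simp add: q_def)
next
  case (Suc n)
  have rec: "of_real (l (Suc n)) * q (Suc (Suc n)) z =
      (of_real (l (Suc n) + m (Suc n)) - z) * q (Suc n) z - of_real (m (Suc n)) * q n z" for z
    unfolding q_def by (rule poly_cpoly_Q_rec)
  have "of_real (l (Suc n) * wt (Suc n)) *
      (q (Suc (Suc n)) x * q (Suc n) y - q (Suc n) x * q (Suc (Suc n)) y) =
      of_real (wt (Suc n)) * ((of_real (l (Suc n)) * q (Suc (Suc n)) x) * q (Suc n) y
        - q (Suc n) x * (of_real (l (Suc n)) * q (Suc (Suc n)) y))"
    by (simp add: algebra_simps)
  also have "\<dots> = (y - x) * (of_real (wt (Suc n)) * q (Suc n) x * q (Suc n) y)
      + of_real (m (Suc n) * wt (Suc n)) * (q (Suc n) x * q n y - q n x * q (Suc n) y)"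
    unfolding rec by (simp add: algebra_simps)
  also have "\<dots> = (y - x) * (of_real (wt (Suc n)) * q (Suc n) x * q (Suc n) y)
      + (y - x) * (\<Sum>k\<le>n. of_real (wt k) * q k x * q k y)"
    unfolding m_wt_Suc Suc ..
  finally show ?case by (simp add: algebra_simps)
qed

lemma christoffel_darboux:
  "l n * wt n * (poly (Q (Suc n)) x * poly (Q n) y - poly (Q n) x * poly (Q (Suc n)) y) =
    (y - x) * kern n x y"
proof -
  have "complex_of_real (l n * wt n *
      (poly (Q (Suc n)) x * poly (Q n) y - poly (Q n) x * poly (Q (Suc n)) y)) =
      of_real ((y - x) * kern n x y)"
    using christoffel_darboux_complex[of n "of_real x" "of_real y"]
    by (simp add: poly_cpoly_of_real kern_def)
  then show ?thesis by (simp only: of_real_eq_iff)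
qed

lemma kern_diag_ge_1: "1 \<le> kern n x x"
proof -
  have "wt 0 * poly (Q 0) x * poly (Q 0) x \<le> kern n x x"
    unfolding kern_def
    by (intro member_le_sum) (auto simp: mult.assoc less_imp_le[OF wt_pos])
  then show ?thesis by simp
qed

text \<open>Two consecutive zeros would propagate down the recurrence to \<open>Q 0 = 1\<close>. This lets any given point be
made a node of a quadrature of arbitrarily high degree.\<close>

lemma Q_no_common_root: "poly (Q n) x \<noteq> 0 \<or> poly (Q (Suc n)) x \<noteq> 0"
proof (induction n)
  case (Suc n)
  have "poly (Q n) x = 0" if "poly (Q (Suc n)) x = 0" "poly (Q (Suc (Suc n))) x = 0"
    using that l_pos[of "Suc n"] m_pos[of n] by (simp add: bd_poly.simps(3))
  with Suc show ?case by blast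
qed simp

section \<open>Roots of quasi-orthogonal polynomials\<close>

text \<open>These are the quasi-orthogonal polynomials of M. Riesz. Varying the parameter \<open>\<tau>\<close> moves the nodes,
which gives the freedom to prescribe one of them.\<close>

definition quasi_orth :: "nat \<Rightarrow> real \<Rightarrow> real poly" where
  "quasi_orth n \<tau> = Q (Suc n) - smult \<tau> (Q n)"

lemma degree_quasi_orth: "degree (quasi_orth n \<tau>) = Suc n"
proof -
  have "degree (- smult \<tau> (Q n)) < degree (Q (Suc n))"
    using degree_smult_le[of \<tau> "Q n"] by (simp add: degree_Q del: degree_smult_eq)
  then show ?thesis
    unfolding quasi_orth_def diff_conv_add_uminus by (subst degree_add_eq_left) (auto simp: degree_Q)
qed

lemma quasi_orth_root_iff: "poly (cpoly (quasi_orth n \<tau>)) z = 0 \<longleftrightarrow>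
    poly (cpoly (Q (Suc n))) z = of_real \<tau> * poly (cpoly (Q n)) z"
  by (simp add: quasi_orth_def cpoly_diff cpoly_smult)

text \<open>At a root \<open>z\<close> and its conjugate the ratio of \<open>Q (n+1)\<close> to \<open>Q n\<close> is the same real number, so the
left-hand side of Christoffel--Darboux vanishes. The kernel at \<open>(z, cnj z)\<close> is at least \<open>1\<close>, hence
\<open>cnj z = z\<close>.\<close>

lemma quasi_orth_roots_real:
  assumes "poly (cpoly (quasi_orth n \<tau>)) z = 0"
  shows "z \<in> \<real>"
proof -
  have root: "poly (cpoly (Q (Suc n))) z = of_real \<tau> * poly (cpoly (Q n)) z"
    using assms by (simp add: quasi_orth_root_iff)
  define S where "S = (\<Sum>k\<le>n. wt k * (cmod (poly (cpoly (Q k)) z))\<^sup>2)"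
  have "(\<Sum>k\<le>n. of_real (wt k) * poly (cpoly (Q k)) z * poly (cpoly (Q k)) (cnj z)) = of_real S"
    unfolding S_def poly_cpoly_cnj of_real_sum
    by (intro sum.cong refl) (simp only: of_real_mult complex_norm_square mult.assoc)
  then have "(cnj z - z) * of_real S = 0"
    using christoffel_darboux_complex[of n z "cnj z"]
    by (simp add: poly_cpoly_cnj root)
  moreover have "S \<noteq> 0"
  proof -
    have "wt 0 * (cmod (poly (cpoly (Q 0)) z))\<^sup>2 \<le> S"
      unfolding S_def by (intro member_le_sum) (auto simp: less_imp_le[OF wt_pos])
    then show ?thesis by simp
  qed
  ultimately have "cnj z = z" by simp
  then show ?thesis by (simp add: Reals_cnj_iff)
qed

text \<open>With the second argument fixed at a root \<open>z\<close>, Christoffel--Darboux writes a multiple of the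
quasi-orthogonal polynomial as \<open>z - x\<close> times the kernel polynomial. A double root would make the kernel
vanish on the diagonal.\<close>

lemma quasi_orth_roots_simple:
  assumes "poly (cpoly (quasi_orth n \<tau>)) z = 0"
  shows "poly (pderiv (cpoly (quasi_orth n \<tau>))) z \<noteq> 0"
proof
  assume deriv: "poly (pderiv (cpoly (quasi_orth n \<tau>))) z = 0"
  obtain t where t: "z = of_real t" using quasi_orth_roots_real[OF assms] by (elim Reals_cases)
  have root: "poly (cpoly (Q (Suc n))) z = of_real \<tau> * poly (cpoly (Q n)) z"
    using assms by (simp add: quasi_orth_root_iff)
  define K where "K = (\<Sum>k\<le>n. smult (of_real (wt k) * poly (cpoly (Q k)) z) (cpoly (Q k)))"
  have K: "poly K x = (\<Sum>k\<le>n. of_real (wt k) * poly (cpoly (Q k)) x * poly (cpoly (Q k)) z)" for x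
    unfolding K_def poly_sum by (intro sum.cong) (auto simp: algebra_simps)
  have "smult (of_real (l n * wt n) * poly (cpoly (Q n)) z) (cpoly (quasi_orth n \<tau>)) = [:z, - 1:] * K"
    unfolding poly_eq_poly_eq_iff[symmetric]
  proof
    fix x
    have "poly (smult (of_real (l n * wt n) * poly (cpoly (Q n)) z) (cpoly (quasi_orth n \<tau>))) x =
        of_real (l n * wt n) * (poly (cpoly (Q (Suc n))) x * poly (cpoly (Q n)) z
          - poly (cpoly (Q n)) x * poly (cpoly (Q (Suc n))) z)"
      unfolding root by (simp add: quasi_orth_def cpoly_diff cpoly_smult algebra_simps)
    also have "\<dots> = (z - x) * poly K x"
      unfolding K by (rule christoffel_darboux_complex)
    finally show "poly (smult (of_real (l n * wt n) * poly (cpoly (Q n)) z) (cpoly (quasi_orth n \<tau>))) x =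
        poly ([:z, - 1:] * K) x" by (simp add: algebra_simps)
  qed
  then have "poly (pderiv (smult (of_real (l n * wt n) * poly (cpoly (Q n)) z) (cpoly (quasi_orth n \<tau>)))) z =
      poly (pderiv ([:z, - 1:] * K)) z" by simp
  then have "poly K z = 0"
    by (simp add: pderiv_smult deriv pderiv_mult pderiv_pCons del: mult_pCons_left)
  moreover have "poly K z = of_real (kern n t t)"
    unfolding K t poly_cpoly_of_real kern_def by simp
  ultimately show False using kern_diag_ge_1[of n t] by simp
qed

lemma quasi_orth_roots:
  "finite {t. poly (quasi_orth n \<tau>) t = 0}" "card {t. poly (quasi_orth n \<tau>) t = 0} = Suc n"
proof -
  define R where "R = cpoly (quasi_orth n \<tau>)"
  have deg: "degree R = Suc n"
    unfolding R_def by (simp add: degree_map_poly degree_quasi_orth)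
  have roots: "{z. poly R z = 0} = of_real ` {t. poly (quasi_orth n \<tau>) t = 0}"
  proof (intro equalityI subsetI)
    fix z assume "z \<in> {z. poly R z = 0}"
    then have "poly R z = 0" by simp
    then obtain t where "z = of_real t"
      using quasi_orth_roots_real unfolding R_def by (metis Reals_cases)
    with \<open>poly R z = 0\<close> show "z \<in> of_real ` {t. poly (quasi_orth n \<tau>) t = 0}"
      by (auto simp: R_def poly_cpoly_of_real)
  qed (auto simp: R_def poly_cpoly_of_real)
  have "rsquarefree R"
    unfolding rsquarefree_roots using quasi_orth_roots_simple by (auto simp: R_def)
  then have "degree (smult (lead_coeff R) (\<Prod>z | poly R z = 0. [:- z, 1:])) = Suc n"
    using complex_poly_decompose_rsquarefree[of R] deg by simp
  then have "card {z. poly R z = 0} = Suc n"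
    using deg by (auto simp: degree_prod_sum_eq split: if_splits)
  then show "card {t. poly (quasi_orth n \<tau>) t = 0} = Suc n"
    unfolding roots by (subst (asm) card_image) (auto simp: inj_on_def)
  then show "finite {t. poly (quasi_orth n \<tau>) t = 0}"
    by (intro card_ge_0_finite) simp
qed

section \<open>Gauss quadratures with a prescribed node\<close>

lemma Q_independent:
  assumes "(\<Sum>k\<le>n. smult (c k) (Q k)) = 0" "k \<le> n"
  shows "c k = 0"
  using assms
proof (induction n arbitrary: k)
  case (Suc n)
  have "coeff (\<Sum>k\<le>n. smult (c k) (Q k)) (Suc n) = 0"
    by (intro coeff_eq_0 le_imp_less_Suc degree_sum_le)
      (auto intro: order_trans[OF degree_smult_le] simp: degree_Q)
  then have "c (Suc n) * coeff (Q (Suc n)) (Suc n) = coeff (\<Sum>k\<le>Suc n. smult (c k) (Q k)) (Suc n)"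
    by simp
  also have "\<dots> = 0" using Suc.prems by simp
  finally have "c (Suc n) = 0"
    using Q_nonzero[of "Suc n"] degree_Q[of "Suc n"] leading_coeff_0_iff[of "Q (Suc n)"]
    by simp
  with Suc show ?case by (cases "k = Suc n") (auto)
qed simp

lemma Q_spanning:
  assumes "degree p \<le> n"
  shows "\<exists>c. p = (\<Sum>k\<le>n. smult (c k) (Q k))"
  using assms
proof (induction n arbitrary: p)
  case 0
  then obtain a where "p = [:a:]" by (auto elim: degree_eq_zeroE)
  then show ?case by (intro exI[of _ "\<lambda>_. a"]) simp
next
  case (Suc n)
  define a where "a = coeff p (Suc n) / lead_coeff (Q (Suc n))"
  have lead: "lead_coeff (Q (Suc n)) \<noteq> 0"
    using Q_nonzero[of "Suc n"] by simp
  have "degree (p - smult a (Q (Suc n))) \<le> n"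
  proof (rule degree_le, intro allI impI)
    fix i assume "n < i"
    then consider "i = Suc n" | "Suc n < i" by linarith
    then show "coeff (p - smult a (Q (Suc n))) i = 0"
    proof cases
      case 1
      then show ?thesis using lead by (simp add: a_def degree_Q)
    next
      case 2
      then show ?thesis using Suc.prems by (simp add: coeff_eq_0 degree_Q)
    qed
  qed
  then obtain c where c: "p - smult a (Q (Suc n)) = (\<Sum>k\<le>n. smult (c k) (Q k))"
    using Suc.IH by blast
  have "p = (\<Sum>k\<le>Suc n. smult ((c(Suc n := a)) k) (Q k))"
    using c by (simp add: algebra_simps)
  then show ?case by blast
qed

text \<open>By Christoffel--Darboux the kernel vanishes at pairs of distinct roots, so the matrix of the normalized values of
\<open>Q 0, ..., Q n\<close> at the \<open>n + 1\<close> roots has orthonormal rows; the claim is that its columns are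
orthonormal too. Instead of inverting a matrix, the proof interpolates: \<open>F\<close> below has degree at most
\<open>n\<close> and vanishes at all \<open>n + 1\<close> roots, so its coefficients in the basis \<open>Q 0, ..., Q n\<close> are zero.
Obtaining the orthogonality in this way avoids constructing the moment functional beforehand.\<close>

lemma christoffel_weights:
  fixes n \<tau>
  defines "S \<equiv> {t. poly (quasi_orth n \<tau>) t = 0}"
  assumes "i \<le> n" "j \<le> n"
  shows "(\<Sum>s\<in>S. 1 / kern n s s * (poly (Q i) s * poly (Q j) s)) = (if i = j then 1 / wt i else 0)"
proof -
  define g where "g k = (\<Sum>s\<in>S. 1 / kern n s s * (poly (Q i) s * poly (Q k) s))" for k
  define c where "c k = wt k * g k - (if k = i then 1 else 0)" for k
  define F where "F = (\<Sum>k\<le>n. smult (c k) (Q k))"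
  have fin: "finite S" and card: "card S = Suc n"
    unfolding S_def by (rule quasi_orth_roots)+
  have off: "kern n s t = 0" if "s \<in> S" "t \<in> S" "s \<noteq> t" for s t
  proof -
    have "poly (Q (Suc n)) s = \<tau> * poly (Q n) s" "poly (Q (Suc n)) t = \<tau> * poly (Q n) t"
      using that by (auto simp: S_def quasi_orth_def)
    then have "(t - s) * kern n s t = 0"
      unfolding christoffel_darboux[symmetric] by simp
    then show ?thesis using that by simp
  qed
  have root: "poly F t = 0" if t: "t \<in> S" for t
  proof -
    have "(\<Sum>k\<le>n. wt k * g k * poly (Q k) t) =
        (\<Sum>k\<le>n. \<Sum>s\<in>S. poly (Q i) s / kern n s s * (wt k * poly (Q k) s * poly (Q k) t))"
      unfolding g_def by (simp add: sum_distrib_left sum_distrib_right algebra_simps)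
    also have "\<dots> = (\<Sum>s\<in>S. poly (Q i) s / kern n s s * kern n s t)"
      unfolding kern_def sum_distrib_left by (rule sum.swap)
    also have "\<dots> = (\<Sum>s\<in>S. if s = t then poly (Q i) t else 0)"
      using off t kern_diag_ge_1[of n t] by (intro sum.cong) auto
    also have "\<dots> = poly (Q i) t" using fin t by simp
    finally have 1: "(\<Sum>k\<le>n. wt k * g k * poly (Q k) t) = poly (Q i) t" .
    have "(\<Sum>k\<le>n. (if k = i then 1 else 0) * poly (Q k) t) = poly (Q i) t"
      using \<open>i \<le> n\<close> by (simp add: if_distrib[of "\<lambda>a. a * _"] cong: if_cong)
    with 1 show ?thesis
      by (simp add: F_def c_def poly_sum left_diff_distrib sum_subtractf)
  qed
  have "F = 0"
  proof (rule ccontr)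
    assume "F \<noteq> 0"
    have "card S \<le> card {t. poly F t = 0}"
      using root \<open>F \<noteq> 0\<close> by (intro card_mono poly_roots_finite) auto
    also have "\<dots> \<le> degree F" using \<open>F \<noteq> 0\<close> by (rule card_poly_roots_bound)
    also have "\<dots> \<le> n"
      unfolding F_def by (intro degree_sum_le) (auto intro: order_trans[OF degree_smult_le] simp: degree_Q)
    finally show False using card by simp
  qed
  then have "c j = 0" unfolding F_def using \<open>j \<le> n\<close> by (rule Q_independent)
  then show ?thesis
    using wt_pos[of j] by (auto simp: c_def g_def field_simps split: if_splits)
qed

definition quadrature :: "nat \<Rightarrow> real measure \<Rightarrow> bool" where
  "quadrature n \<mu> \<longleftrightarrow> real_distribution \<mu>
    \<and> (\<forall>f :: real \<Rightarrow> real. f \<in> borel_measurable borel \<longrightarrow> integrable \<mu> f)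
    \<and> (\<forall>i\<le>n. \<forall>j\<le>n. (\<integral>t. poly (Q i) t * poly (Q j) t \<partial>\<mu>) = (if i = j then 1 / wt i else 0))"

text \<open>The choice \<open>\<tau> = Q (n+1) x / Q n x\<close> makes \<open>x\<close> one of the nodes.\<close>

lemma quadrature_of_roots:
  assumes "poly (Q n) x \<noteq> 0"
  shows "\<exists>\<mu>. quadrature n \<mu> \<and> measure \<mu> {x} = 1 / kern n x x"
proof -
  define \<tau> where "\<tau> = poly (Q (Suc n)) x / poly (Q n) x"
  define S where "S = {t. poly (quasi_orth n \<tau>) t = 0}"
  define P where "P = point_measure S (\<lambda>s. ennreal (1 / kern n s s))"
  define \<mu> where "\<mu> = distr P borel (\<lambda>t. t)"
  have fin: "finite S" unfolding S_def by (rule quasi_orth_roots)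
  have "x \<in> S" using assms by (simp add: S_def quasi_orth_def \<tau>_def)
  have w: "0 \<le> 1 / kern n s s" for s using kern_diag_ge_1[of n s] by simp
  have [measurable]: "(\<lambda>t. t) \<in> P \<rightarrow>\<^sub>M borel" by (simp add: P_def)
  have integral: "(\<integral>t. f t \<partial>\<mu>) = (\<Sum>s\<in>S. 1 / kern n s s * f s)"
    if "f \<in> borel_measurable borel" for f :: "real \<Rightarrow> real"
    unfolding \<mu>_def using that fin w
    by (simp add: integral_distr P_def lebesgue_integral_point_measure_finite)
  have orth: "(\<integral>t. poly (Q i) t * poly (Q j) t \<partial>\<mu>) = (if i = j then 1 / wt i else 0)"
    if "i \<le> n" "j \<le> n" for i j
    by (subst integral) (simp_all only: S_def christoffel_weights[OF that, of \<tau>], measurable)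
  have mass: "(\<Sum>s\<in>S. 1 / kern n s s) = 1"
    using christoffel_weights[of 0 n 0 \<tau>] by (simp add: S_def)
  have "emeasure P (space P) = 1"
    using fin w mass by (simp add: P_def space_point_measure emeasure_point_measure_finite sum_ennreal)
  then interpret P: prob_space P by (rule prob_spaceI)
  have "real_distribution \<mu>" unfolding \<mu>_def by simp
  moreover have "integrable \<mu> f" if "f \<in> borel_measurable borel" for f :: "real \<Rightarrow> real"
    unfolding \<mu>_def using that fin
    by (simp add: integrable_distr_eq P_def integrable_point_measure_finite)
  moreover have "measure \<mu> {x} = 1 / kern n x x"
  proof -
    have "measure \<mu> {x} = (\<integral>t. indicator {x} t \<partial>\<mu>)" by (simp add: \<mu>_def)
    also have "\<dots> = (\<Sum>s\<in>S. if s = x then 1 / kern n x x else 0)"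
      by (subst integral) (auto intro!: sum.cong)
    finally show ?thesis using fin \<open>x \<in> S\<close> by simp
  qed
  ultimately show ?thesis using orth unfolding quadrature_def by blast
qed

lemma ex_quadrature_with_atom:
  "\<exists>\<mu>. quadrature n \<mu> \<and> (\<exists>k. measure \<mu> {x} = 1 / kern k x x)"
  using Q_no_common_root[of n x]
proof
  assume "poly (Q n) x \<noteq> 0"
  from quadrature_of_roots[OF this] show ?thesis by blast
next
  assume "poly (Q (Suc n)) x \<noteq> 0"
  from quadrature_of_roots[OF this] show ?thesis by (auto simp: quadrature_def)
qed

text \<open>Expanding \<open>p\<close> in the basis \<open>Q k\<close>, every quadrature of sufficient order integrates \<open>p\<close> to its
coefficient at \<open>Q 0 = 1\<close>. So the moments of the quadratures stabilize, and \<open>L\<close> is the moment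
functional.\<close>

lemma quadrature_moments:
  "\<exists>L. \<forall>p n \<mu>. degree p \<le> n \<longrightarrow> quadrature n \<mu> \<longrightarrow> (\<integral>t. poly p t \<partial>\<mu>) = L p"
proof -
  have "\<exists>a. \<forall>n \<mu>. degree p \<le> n \<longrightarrow> quadrature n \<mu> \<longrightarrow> (\<integral>t. poly p t \<partial>\<mu>) = a" for p
  proof -
    obtain c where c: "p = (\<Sum>k\<le>degree p. smult (c k) (Q k))" using Q_spanning[of p] by blast
    show ?thesis
    proof (intro exI[of _ "c 0"] allI impI)
      fix n \<mu>
      assume n: "degree p \<le> n" and \<mu>: "quadrature n \<mu>"
      have "poly p t = (\<Sum>k\<le>degree p. c k * poly (Q k) t)" for t
        using arg_cong[OF c, of "\<lambda>p. poly p t"] by (simp add: poly_sum)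
      then have "(\<integral>t. poly p t \<partial>\<mu>) = (\<integral>t. (\<Sum>k\<le>degree p. c k * poly (Q k) t) \<partial>\<mu>)" by simp
      also have "\<dots> = (\<Sum>k\<le>degree p. c k * (\<integral>t. poly (Q k) t \<partial>\<mu>))"
        using \<mu> by (subst Bochner_Integration.integral_sum) (auto simp: quadrature_def)
      also have "\<dots> = (\<Sum>k\<le>degree p. if k = 0 then c 0 else 0)"
      proof (intro sum.cong refl)
        fix k assume "k \<in> {..degree p}"
        moreover have "(\<integral>t. poly (Q i) t * poly (Q 0) t \<partial>\<mu>) = (if i = 0 then 1 / wt i else 0)"
          if "i \<le> n" for i
          using \<mu> that unfolding quadrature_def by blast
        ultimately show "c k * (\<integral>t. poly (Q k) t \<partial>\<mu>) = (if k = 0 then c 0 else 0)"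
          using n by auto
      qed
      finally show "(\<integral>t. poly p t \<partial>\<mu>) = c 0" by simp
    qed
  qed
  then show ?thesis by metis
qed

section \<open>Solutions of the moment problem with a prescribed atom\<close>

lemma ex_solution_with_atom:
  assumes B: "\<And>n. kern n x x \<le> B"
  shows "\<exists>M. hamburger_solution (bd_orthonormal l m) M \<and> 1 / B \<le> measure M {x}"
proof -
  obtain \<nu> where \<nu>: "\<And>n. quadrature n (\<nu> n)" and \<nu>_atom: "\<And>n. \<exists>k. measure (\<nu> n) {x} = 1 / kern k x x"
    using ex_quadrature_with_atom[of _ x] by metis
  obtain L where L: "\<And>p n \<mu>. degree p \<le> n \<Longrightarrow> quadrature n \<mu> \<Longrightarrow> (\<integral>t. poly p t \<partial>\<mu>) = L p"
    using quadrature_moments by metis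
  have dist: "real_distribution (\<nu> n)" for n using \<nu> by (simp add: quadrature_def)
  have int: "integrable (\<nu> n) f" if "f \<in> borel_measurable borel" for n and f :: "real \<Rightarrow> real"
    using \<nu> that by (simp add: quadrature_def)
  have atom: "1 / B \<le> measure (\<nu> n) {x}" for n
  proof -
    obtain k where "measure (\<nu> n) {x} = 1 / kern k x x" using \<nu>_atom by blast
    moreover have "1 / B \<le> 1 / kern k x x"
      using B[of k] kern_diag_ge_1[of k x] by (intro divide_left_mono) auto
    ultimately show ?thesis by simp
  qed
  \<comment> \<open>From index \<open>2\<close> on the second moment is the same for all quadratures, which gives tightness.\<close>
  define \<mu> where "\<mu> n = \<nu> (n + 2)" for n
  have mom2: "(\<integral>t. t\<^sup>2 \<partial>\<mu> n) = L (monom 1 2)" for n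
    using L[of "monom 1 2" "n + 2" "\<mu> n"] \<nu> by (simp add: \<mu>_def poly_monom degree_monom_eq)
  have "tight \<mu>"
    by (rule tight_of_bounded_second_moment[where B = "L (monom 1 2)"])
      (auto simp: mom2, auto simp: \<mu>_def dist int)
  from tight_imp_convergent_subsubsequence[OF this strict_mono_id]
  obtain r M where r: "strict_mono r" and M: "real_distribution M"
    and conv: "weak_conv_m (\<mu> \<circ> id \<circ> r) M" by blast
  define \<mu>' where "\<mu>' = (\<mu> \<circ> id \<circ> r)"
  have \<mu>': "\<mu>' n = \<nu> (r n + 2)" for n by (simp add: \<mu>'_def \<mu>_def)
  have mom: "(\<integral>t. poly p t \<partial>\<mu>' n) = L p" if "degree p \<le> n" for p n
    using L[of p "r n + 2" "\<mu>' n"] \<nu> that seq_suble[OF r, of n] by (simp add: \<mu>')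
  have dist': "real_distribution (\<mu>' n)" and int': "f \<in> borel_measurable borel \<Longrightarrow> integrable (\<mu>' n) f"
    for n and f :: "real \<Rightarrow> real" by (auto simp: \<mu>' dist int)
  interpret M: real_distribution M by fact
  \<comment> \<open>The shift by \<open>N\<close> makes the integrals of \<open>p\<close> and of \<open>p\<^sup>2\<close> constant along the sequence.\<close>
  have limit: "integrable M (\<lambda>t. poly p t) \<and> (\<integral>t. poly p t \<partial>M) = L p" for p
  proof -
    define N where "N = degree p + degree (p\<^sup>2)"
    have conv': "weak_conv_m (\<lambda>n. \<mu>' (n + N)) M"
      using conv unfolding \<mu>'_def weak_conv_m_def weak_conv_def
      by (auto intro: LIMSEQ_ignore_initial_segment)
    have sq: "(\<integral>t. (poly p t)\<^sup>2 \<partial>\<mu>' (n + N)) \<le> L (p\<^sup>2)" for n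
      using mom[of "p\<^sup>2" "n + N"] by (simp add: N_def)
    have "(\<lambda>n. \<integral>t. poly p t \<partial>\<mu>' (n + N)) \<longlonglongrightarrow> L p"
      by (subst mom) (auto simp: N_def)
    from weak_limit_integral[OF dist' M conv' _ int' int' sq this]
    show ?thesis by simp
  qed
  have orth: "(\<integral>t. poly (Q i) t * poly (Q j) t \<partial>M) = (if i = j then 1 / wt i else 0)" for i j
  proof -
    define n where "n = i + j + degree (Q i * Q j)"
    have "(\<integral>t. poly (Q i) t * poly (Q j) t \<partial>M) = L (Q i * Q j)"
      using limit[of "Q i * Q j"] by simp
    also have "\<dots> = (\<integral>t. poly (Q i) t * poly (Q j) t \<partial>\<nu> n)"
      using L[of "Q i * Q j" n "\<nu> n"] \<nu> by (simp add: n_def)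
    also have "\<dots> = (if i = j then 1 / wt i else 0)"
      using \<nu>[of n] by (simp add: quadrature_def n_def)
    finally show ?thesis .
  qed
  have "integrable M (\<lambda>t. t ^ k)" for k
    using limit[of "monom 1 k"] by (simp add: poly_monom)
  moreover have "(\<integral>t. poly (bd_orthonormal l m i) t * poly (bd_orthonormal l m j) t \<partial>M) =
      (if i = j then 1 else 0)" for i j
  proof -
    have "(\<integral>t. poly (bd_orthonormal l m i) t * poly (bd_orthonormal l m j) t \<partial>M) =
        (\<integral>t. ((- 1) ^ i * (- 1) ^ j * sqrt (wt i) * sqrt (wt j)) * (poly (Q i) t * poly (Q j) t) \<partial>M)"
      by (intro Bochner_Integration.integral_cong refl)
        (simp add: bd_orthonormal_def wt_def algebra_simps)
    also have "\<dots> = ((- 1) ^ i * (- 1) ^ j * sqrt (wt i) * sqrt (wt j)) * (if i = j then 1 / wt i else 0)"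
      using limit[of "Q i * Q j"] by (simp only: orth[symmetric]) simp
    also have "\<dots> = (if i = j then 1 else 0)"
      using wt_pos[of i] by (auto simp: power_add[symmetric] mult_2[symmetric])
    finally show ?thesis .
  qed
  ultimately have "hamburger_solution (bd_orthonormal l m) M"
    unfolding hamburger_solution_def using M.prob_space_axioms by simp
  moreover have "1 / B \<le> measure M {x}"
    by (rule weak_limit_atom[OF dist' M conv[folded \<mu>'_def]]) (simp add: \<mu>' atom)
  ultimately show ?thesis by blast
qed

section \<open>Indeterminacy from two convergent series\<close>

text \<open>The pair \<open>(Q n, D n)\<close> evolves by \<open>Q (n+1) = Q n + D n / (l n * wt n)\<close> and
\<open>D (n+1) = D n - x * wt (n+1) * Q (n+1)\<close>, so for \<open>\<bar>x\<bar> \<le> 1\<close> one step multiplies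
\<open>\<bar>Q n\<bar> + \<bar>D n\<bar>\<close> by at most \<open>(1 + wt (n+1)) * (1 + 1 / (l n * wt n))\<close>.\<close>

lemma Q_growth:
  fixes x :: real
  assumes "\<bar>x\<bar> \<le> 1"
  defines "D n \<equiv> l n * wt n * (poly (Q (Suc n)) x - poly (Q n) x)"
  shows "\<bar>poly (Q n) x\<bar> + \<bar>D n\<bar> \<le> (2 + \<bar>m 0\<bar>) * exp (\<Sum>k<n. wt (Suc k) + 1 / (l k * wt k))"
proof (induction n)
  case 0
  have "D 0 = m 0 - x"
    using l_pos[of 0] by (simp add: D_def bd_poly.simps(2) field_simps)
  then show ?case using assms by simp
next
  case (Suc n)
  define r where "r = 1 / (l n * wt n)"
  have r: "0 \<le> r" using l_pos[of n] wt_pos[of n] by (simp add: r_def)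
  have w: "0 \<le> wt (Suc n)" using wt_pos by (rule less_imp_le)
  have "l n * wt n \<noteq> 0" using l_pos[of n] wt_pos[of n] by simp
  then have Q': "poly (Q (Suc n)) x = poly (Q n) x + r * D n"
    by (simp add: r_def D_def)
  have "l (Suc n) * poly (Q (Suc (Suc n))) x =
      (l (Suc n) + m (Suc n) - x) * poly (Q (Suc n)) x - m (Suc n) * poly (Q n) x"
    using bd_poly_recurrence[of "Suc n" l x m] l_pos[of "Suc n"] by (simp add: algebra_simps)
  moreover have "D (Suc n) = wt (Suc n) *
      (l (Suc n) * poly (Q (Suc (Suc n))) x - l (Suc n) * poly (Q (Suc n)) x)"
    by (simp add: D_def algebra_simps)
  ultimately have "D (Suc n) = wt (Suc n) * ((l (Suc n) + m (Suc n) - x) * poly (Q (Suc n)) x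
      - m (Suc n) * poly (Q n) x - l (Suc n) * poly (Q (Suc n)) x)"
    by simp
  also have "\<dots> = (m (Suc n) * wt (Suc n)) * (poly (Q (Suc n)) x - poly (Q n) x)
      - x * wt (Suc n) * poly (Q (Suc n)) x"
    by (simp add: algebra_simps)
  also have "\<dots> = D n - x * wt (Suc n) * poly (Q (Suc n)) x"
    by (simp only: m_wt_Suc D_def)
  finally have D': "D (Suc n) = D n - x * wt (Suc n) * poly (Q (Suc n)) x" .
  have "\<bar>x * wt (Suc n) * poly (Q (Suc n)) x\<bar> \<le> 1 * wt (Suc n) * \<bar>poly (Q (Suc n)) x\<bar>"
    unfolding abs_mult using w assms by (intro mult_right_mono) (auto intro!: mult_left_le_one_le)
  then have "\<bar>poly (Q (Suc n)) x\<bar> + \<bar>D (Suc n)\<bar> \<le>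
      \<bar>poly (Q (Suc n)) x\<bar> + (\<bar>D n\<bar> + wt (Suc n) * \<bar>poly (Q (Suc n)) x\<bar>)"
    unfolding D' by linarith
  also have "\<dots> \<le> (1 + wt (Suc n)) * (\<bar>poly (Q (Suc n)) x\<bar> + \<bar>D n\<bar>)"
    using w by (simp add: algebra_simps)
  also have "\<bar>poly (Q (Suc n)) x\<bar> \<le> \<bar>poly (Q n) x\<bar> + r * \<bar>D n\<bar>"
    unfolding Q' using abs_triangle_ineq[of "poly (Q n) x" "r * D n"] r by (simp add: abs_mult)
  also have "\<bar>poly (Q n) x\<bar> + r * \<bar>D n\<bar> + \<bar>D n\<bar> \<le> (1 + r) * (\<bar>poly (Q n) x\<bar> + \<bar>D n\<bar>)"
    using r by (simp add: algebra_simps)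
  also have "(1 + wt (Suc n)) * ((1 + r) * (\<bar>poly (Q n) x\<bar> + \<bar>D n\<bar>)) \<le>
      exp (wt (Suc n)) * (exp r * ((2 + \<bar>m 0\<bar>) * exp (\<Sum>k<n. wt (Suc k) + 1 / (l k * wt k))))"
    using r w Suc by (intro mult_mono exp_ge_add_one_self) auto
  also have "\<dots> = (2 + \<bar>m 0\<bar>) * exp (\<Sum>k<Suc n. wt (Suc k) + 1 / (l k * wt k))"
    by (simp add: exp_add r_def)
  finally show ?case using w r by (simp add: mult_left_mono)
qed

text \<open>A unique solution would carry mass at least \<open>1/B\<close> at each of \<open>k > B\<close> points of the unit interval.\<close>

theorem indeterminate_of_summable:
  assumes sum_wt: "summable wt" and sum_lwt: "summable (\<lambda>n. 1 / (l n * wt n))"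
  shows "indeterminate (bd_orthonormal l m)"
proof -
  define T where "T = (\<Sum>k. wt (Suc k) + 1 / (l k * wt k))"
  define C where "C = (2 + \<bar>m 0\<bar>) * exp T"
  define B where "B = C\<^sup>2 * (\<Sum>k. wt k)"
  have Q_bound: "\<bar>poly (Q n) x\<bar> \<le> C" if "\<bar>x\<bar> \<le> 1" for n x
  proof -
    have "summable (\<lambda>k. wt (Suc k) + 1 / (l k * wt k))"
      using sum_wt sum_lwt by (intro summable_add) (simp_all add: summable_Suc_iff)
    then have "(\<Sum>k<n. wt (Suc k) + 1 / (l k * wt k)) \<le> T"
      unfolding T_def using wt_pos l_pos by (intro sum_le_suminf) (auto intro!: add_nonneg_nonneg simp: less_imp_le)
    then have "(2 + \<bar>m 0\<bar>) * exp (\<Sum>k<n. wt (Suc k) + 1 / (l k * wt k)) \<le> C"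
      unfolding C_def by (intro mult_left_mono) auto
    then show ?thesis using Q_growth[OF that, of n] by linarith
  qed
  have kern_bound: "kern n x x \<le> B" if "\<bar>x\<bar> \<le> 1" for n x
  proof -
    have "kern n x x \<le> (\<Sum>k\<le>n. wt k * C\<^sup>2)"
      unfolding kern_def mult.assoc power2_eq_square[symmetric]
      using power_mono[OF Q_bound[OF that] abs_ge_zero, of _ 2] less_imp_le[OF wt_pos]
      by (intro sum_mono mult_left_mono) auto
    also have "\<dots> = C\<^sup>2 * (\<Sum>k\<le>n. wt k)" by (simp add: sum_distrib_left mult.commute)
    also have "\<dots> \<le> B"
      unfolding B_def using sum_wt wt_pos by (intro mult_left_mono sum_le_suminf) (auto simp: less_imp_le)
    finally show ?thesis .
  qed
  have "1 \<le> B" using kern_diag_ge_1[of 0 0] kern_bound[of 0 0] by simp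
  define k where "k = nat \<lceil>B\<rceil> + 1"
  have k: "B < real k" unfolding k_def by linarith
  define X where "X = (\<lambda>i. real i / real k) ` {..<k}"
  have X: "finite X" "card X = k"
    unfolding X_def by (auto simp: card_image inj_on_def k_def)
  have sol: "\<exists>M. hamburger_solution (bd_orthonormal l m) M \<and> 1 / B \<le> measure M {x}" if "x \<in> X" for x
    using that by (intro ex_solution_with_atom kern_bound) (auto simp: X_def)
  show ?thesis
  proof (rule ccontr)
    assume "\<not> indeterminate (bd_orthonormal l m)"
    then have unique: "M = N" if "hamburger_solution (bd_orthonormal l m) M"
      "hamburger_solution (bd_orthonormal l m) N" for M N
      using that by (auto simp: indeterminate_def)
    obtain M where M: "hamburger_solution (bd_orthonormal l m) M"
      using ex_solution_with_atom[OF kern_bound[of 0]] by auto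
    then interpret M: prob_space M by (simp add: hamburger_solution_def)
    have atom: "1 / B \<le> measure M {x}" if "x \<in> X" for x
      using sol[OF that] unique[OF M] by auto
    have "real k * (1 / B) \<le> (\<Sum>x\<in>X. measure M {x})"
      using sum_mono[of X "\<lambda>_. 1 / B" "\<lambda>x. measure M {x}"] atom X by simp
    also have "\<dots> = measure M X"
      using M X by (intro M.finite_measure_eq_sum_singleton[symmetric]) (auto simp: hamburger_solution_def)
    also have "\<dots> \<le> 1" by simp
    finally show False using k \<open>1 \<le> B\<close> by (simp add: field_simps)
  qed
qed

end

section \<open>The Conrad--Flajolet rates\<close>

lemma summable_of_raabe_limit:
  fixes f :: "nat \<Rightarrow> real"
  assumes "\<And>n. 0 < f n" "(\<lambda>n. real n * (f n / f (Suc n) - 1)) \<longlonglongrightarrow> L" "1 < L"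
  shows "summable f"
proof (rule raabes_test_convergence)
  have "(\<lambda>n. ereal (real n * (f n / f (Suc n) - 1))) \<longlonglongrightarrow> ereal L"
    using assms(2) by simp
  then show "1 < liminf (\<lambda>n. ereal (real n * (f n / f (Suc n) - 1)))"
    using lim_imp_Liminf[of sequentially] assms(3) by (metis less_ereal.simps(1) one_ereal_def trivial_limit_sequentially)
qed (use assms in auto)

text \<open>The quotients \<open>f n / f (n+1)\<close> for \<open>f = wt\<close> and for \<open>f n = 1 / (l n * wt n)\<close> are
\<open>m (n+1) / l n\<close> and \<open>l (n+1) / m (n+1)\<close>, so Raabe's test can be read off from the rates.\<close>

theorem (in birth_death) indeterminate_of_limits:
  assumes "(\<lambda>n. real n * (m (Suc n) / l n - 1)) \<longlonglongrightarrow> a" "1 < a"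
    and "(\<lambda>n. real n * (l (Suc n) / m (Suc n) - 1)) \<longlonglongrightarrow> b" "1 < b"
  shows "indeterminate (bd_orthonormal l m)"
proof (rule indeterminate_of_summable)
  have "wt n / wt (Suc n) = m (Suc n) / l n" for n
    using wt_pos[of n] by (simp add: wt_Suc)
  then show "summable wt"
    using assms wt_pos by (intro summable_of_raabe_limit[where L = a]) auto
  have "(1 / (l n * wt n)) / (1 / (l (Suc n) * wt (Suc n))) = l (Suc n) / m (Suc n)" for n
    using wt_pos[of n] l_pos[of n] by (simp add: wt_Suc)
  then show "summable (\<lambda>n. 1 / (l n * wt n))"
    using assms wt_pos l_pos by (intro summable_of_raabe_limit[where L = b]) auto
qed

theorem mainTheorem5:
  fixes c :: real
  assumes "c > 0"
  shows "indeterminate (bd_orthonormal (cf1_birth c) (cf1_death c)) \<and>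
         indeterminate (bd_orthonormal (cf2_birth c) (cf2_death c))"
proof
  interpret I: birth_death "cf1_birth c" "cf1_death c"
    using assms by unfold_locales (auto simp: cf1_birth_def cf1_death_def intro!: mult_pos_pos)
  show "indeterminate (bd_orthonormal (cf1_birth c) (cf1_death c))"
  proof (rule I.indeterminate_of_limits)
    show "(\<lambda>n. real n * (cf1_death c (Suc n) / cf1_birth c n - 1)) \<longlonglongrightarrow> 5 / 3"
      unfolding cf1_birth_def cf1_death_def by (real_asymp simp add: field_simps)
    show "(\<lambda>n. real n * (cf1_birth c (Suc n) / cf1_death c (Suc n) - 1)) \<longlonglongrightarrow> 4 / 3"
      unfolding cf1_birth_def cf1_death_def by (real_asymp simp add: field_simps)
  qed simp_all
  interpret II: birth_death "cf2_birth c" "cf2_death c"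
    using assms by unfold_locales (auto simp: cf2_birth_def cf2_death_def intro!: mult_pos_pos)
  show "indeterminate (bd_orthonormal (cf2_birth c) (cf2_death c))"
  proof (rule II.indeterminate_of_limits)
    show "(\<lambda>n. real n * (cf2_death c (Suc n) / cf2_birth c n - 1)) \<longlonglongrightarrow> 4 / 3"
      unfolding cf2_birth_def cf2_death_def by (real_asymp simp add: field_simps)
    show "(\<lambda>n. real n * (cf2_birth c (Suc n) / cf2_death c (Suc n) - 1)) \<longlonglongrightarrow> 5 / 3"
      unfolding cf2_birth_def cf2_death_def by (real_asymp simp add: field_simps)
  qed simp_all
qed

end
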